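(* (Synopsis Support Pruning) Given a synopsis entry $M_i$ and a support threshold $k$, the entry $M_i$ can be safely pruned if it holds that $M_i.ub\_sup_r<k$, where $M_i.ub\_sup_r$ is the maximum edge support upper bound in all $(2r)$-hop subgraphs of vertices under $M_i$.
   Context: A bipartite graph $G$ has two disjoint vertex sets $U(G)$ (users) and $L(G)$ (items) and a set $E(G)$ of edges $e_{u,v}$ with $u\in U(G)$, $v\in L(G)$. Each item $v$ has a keyword set $v.K$, and each edge $e_{u,v}$ has a weight $w_{u,v}$ (the frequency of interaction between $u$ and $v$). Subgraphs inherit weights and keyword sets. $G_t$ is a bipartite graph of this kind (the snapshot at time $t$ of a streaming bipartite network), and $N(x)$ is the set of neighbors of a vertex $x$ in $G_t$. A wedge $\angle(u_i,v,u_j)$ is a path $u_i - v - u_j$ with $u_i,u_j$ users and $v$ an item; its weight is $\min\{w_{u_i,v},w_{u_j,v}\}$. A butterfly $\Join(u_i,u_j,v_a,v_b)$, with two users $u_i,u_j$ and two items $v_a,v_b$, is a complete bipartite subgraph containing the wedges $\angle(u_i,v_a,u_j)$ and $\angle(u_i,v_b,u_j)$; its score is the product of the weights of these two wedges. The support $sup(e)$ of an edge $e$ in a subgraph is the number of butterflies of that subgraph containing $e$. The user relationship score $score_{u_i,u_j}(g)$ is the sum of the scores of all butterflies of $g$ containing both $u_i$ and $u_j$ (each pair $\{v_a,v_b\}$ counted once). Given a center user $u_c\in U(G_t)$, a threshold $k$ of butterfly number, a maximum radius $r$ and a score threshold $\sigma$, a $(k,r,\sigma)$-bitruss is a connected subgraph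 $h$ of $G_t$ with $u_c\in h$ such that: (Support) every edge of $h$ has support at least $k$; (Radius) every user $u_i\in U(h)$ satisfies $dist(u_c,u_i)\le 2r$, where $dist$ is the shortest-path distance in $h$; (Score) for any two users $u_i,u_j$ in a wedge $\angle(u_i,v,u_j)$ of $h$, $score_{u_i,u_j}(h)\ge\sigma$. Given in addition a set $Q$ of query keywords, the CD-SBN problem (community detection over a streaming bipartite network) asks for the subgraphs of $G_t$ that are $(k,r,\sigma)$-bitrusses and all of whose items $v$ satisfy $v.K\cap Q\neq\emptyset$; these are the CD-SBN answers. The edge support upper bound of $e_{u,v}\in E(G_t)$ is $ub\_sup(e_{u,v})=\sum_{v_x\in N(u)-\{v\}}|N(v)\cap N(v_x)-\{u\}|$. For a user $u$, $hop(u,2r)$ is the $(2r)$-hop subgraph of $G_t$ centered at $u$ (extracted by breadth-first search from $u$ to radius $2r$), and $u.ub\_sup_r=\max_{e\in hop(u,2r)}ub\_sup(e)$. The synopsis is a tree built over the user vertices of $G_t$; each entry $M_i$ of a node corresponds to a group of users (the users "under" $M_i$), and $M_i.ub\_sup_r=\max_{u\in M_i}u.ub\_sup_r$. "Can be safely pruned" means that $M_i$ can be discarded from the search for CD-SBN answers because it cannot contain any vertices in the CD-SBN answer.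
   Formalization: A (k,r,σ)-bitruss is additionally required to have at least one edge; otherwise the subgraph consisting of the center user alone satisfies all conditions vacuously and the pruning claim fails. *)

theory Defs
  imports Complex_Main "HOL-Library.Extended_Nat"
begin

(* An edge is stored as the pair (user, item).  The values of weight outside the edges and of
   kws outside the items carry no meaning. *)
record ('a, 'k) bigraph =
  users :: "'a set"
  items :: "'a set"
  edges :: "('a \<times> 'a) set"
  weight :: "'a \<times> 'a \<Rightarrow> real"
  kws :: "'a \<Rightarrow> 'k set"

definition bipartite_graph :: "('a, 'k) bigraph \<Rightarrow> bool" where
  "bipartite_graph g \<longleftrightarrow>
     finite (users g) \<and> finite (items g) \<and> users g \<inter> items g = {} \<and>
     edges g \<subseteq> users g \<times> items g"

definition verts :: "('a, 'k) bigraph \<Rightarrow> 'a set" where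
  "verts g = users g \<union> items g"

definition subgraph :: "('a, 'k) bigraph \<Rightarrow> ('a, 'k) bigraph \<Rightarrow> bool" where
  "subgraph h g \<longleftrightarrow>
     bipartite_graph h \<and>
     users h \<subseteq> users g \<and> items h \<subseteq> items g \<and> edges h \<subseteq> edges g \<and>
     (\<forall>e \<in> edges h. weight h e = weight g e) \<and>
     (\<forall>v \<in> items h. kws h v = kws g v)"

definition adj :: "('a, 'k) bigraph \<Rightarrow> ('a \<times> 'a) set" where
  "adj g = edges g \<union> (edges g)\<inverse>"

definition nbrs :: "('a, 'k) bigraph \<Rightarrow> 'a \<Rightarrow> 'a set" where
  "nbrs g x = {y. (x, y) \<in> adj g}"

definition connected_graph :: "('a, 'k) bigraph \<Rightarrow> bool" where
  "connected_graph g \<longleftrightarrow> (\<forall>x \<in> verts g. \<forall>y \<in> verts g. (x, y) \<in> (adj g)\<^sup>*)"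

(* The least length of a walk, which is the length of a shortest path; infinite if there is none. *)
definition graph_dist :: "('a, 'k) bigraph \<Rightarrow> 'a \<Rightarrow> 'a \<Rightarrow> enat" where
  "graph_dist g x y = Inf {enat n | n. (x, y) \<in> adj g ^^ n}"

definition wedge :: "('a, 'k) bigraph \<Rightarrow> 'a \<Rightarrow> 'a \<Rightarrow> 'a \<Rightarrow> bool" where
  "wedge g ui v uj \<longleftrightarrow> ui \<noteq> uj \<and> (ui, v) \<in> edges g \<and> (uj, v) \<in> edges g"

(* A butterfly is the pair of its set of two users and its set of two items, so that it is not
   counted repeatedly under reorderings of its vertices. *)
definition butterflies :: "('a, 'k) bigraph \<Rightarrow> ('a set \<times> 'a set) set" where
  "butterflies g =
     {({ui, uj}, {va, vb}) | ui uj va vb. wedge g ui va uj \<and> wedge g ui vb uj \<and> va \<noteq> vb}"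

(* For A = {ui, uj}, the inner minimum is the weight of the wedge (ui, v, uj). *)
definition butterfly_score :: "('a, 'k) bigraph \<Rightarrow> 'a set \<times> 'a set \<Rightarrow> real" where
  "butterfly_score g = (\<lambda>(A, B). \<Prod>v\<in>B. Min ((\<lambda>u. weight g (u, v)) ` A))"

definition support :: "('a, 'k) bigraph \<Rightarrow> 'a \<times> 'a \<Rightarrow> nat" where
  "support g e = card {(A, B). (A, B) \<in> butterflies g \<and> e \<in> A \<times> B}"

definition user_score :: "('a, 'k) bigraph \<Rightarrow> 'a \<Rightarrow> 'a \<Rightarrow> real" where
  "user_score g ui uj =
     (\<Sum>b \<in> {(A, B). (A, B) \<in> butterflies g \<and> ui \<in> A \<and> uj \<in> A}. butterfly_score g b)"

(* The condition edges h \<noteq> {} excludes the one-vertex subgraph consisting of the center alone,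
   which would otherwise be a bitruss, vacuously, for all k, r and \<sigma>. *)
definition bitruss ::
  "('a, 'k) bigraph \<Rightarrow> 'a \<Rightarrow> nat \<Rightarrow> nat \<Rightarrow> real \<Rightarrow> ('a, 'k) bigraph \<Rightarrow> bool" where
  "bitruss G uc k r \<sigma> h \<longleftrightarrow>
     subgraph h G \<and> connected_graph h \<and> edges h \<noteq> {} \<and> uc \<in> users h \<and>
     (\<forall>e \<in> edges h. support h e \<ge> k) \<and>
     (\<forall>u \<in> users h. graph_dist h uc u \<le> enat (2 * r)) \<and>
     (\<forall>ui v uj. wedge h ui v uj \<longrightarrow> user_score h ui uj \<ge> \<sigma>)"

definition cd_sbn_answer ::
  "('a, 'k) bigraph \<Rightarrow> 'a \<Rightarrow> nat \<Rightarrow> nat \<Rightarrow> real \<Rightarrow> 'k set \<Rightarrow> ('a, 'k) bigraph \<Rightarrow> bool" where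
  "cd_sbn_answer G uc k r \<sigma> Q h \<longleftrightarrow>
     bitruss G uc k r \<sigma> h \<and> (\<forall>v \<in> items h. kws h v \<inter> Q \<noteq> {})"

definition ub_sup :: "('a, 'k) bigraph \<Rightarrow> 'a \<times> 'a \<Rightarrow> nat" where
  "ub_sup G = (\<lambda>(u, v). \<Sum>vx \<in> nbrs G u - {v}. card (nbrs G v \<inter> nbrs G vx - {u}))"

definition hop :: "('a, 'k) bigraph \<Rightarrow> 'a \<Rightarrow> nat \<Rightarrow> ('a, 'k) bigraph" where
  "hop G u d =
     (let R = {x. graph_dist G u x \<le> enat d}
      in G\<lparr>users := users G \<inter> R, items := items G \<inter> R, edges := edges G \<inter> R \<times> R\<rparr>)"

(* In both maxima below, 0 is inserted so that the maximum over an empty set is 0. *)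
definition user_ub_sup :: "('a, 'k) bigraph \<Rightarrow> nat \<Rightarrow> 'a \<Rightarrow> nat" where
  "user_ub_sup G r u = Max (insert 0 (ub_sup G ` edges (hop G u (2 * r))))"

(* A node of the synopsis is a list of entries; an entry is either a single user (in a leaf node)
   or a pointer to a child node. *)
datatype 'a entry = User 'a | Child "'a entry list"

primrec under :: "'a entry \<Rightarrow> 'a set" where
  "under (User u) = {u}"
| "under (Child es) = \<Union> (set (map under es))"

primrec sub_entries :: "'a entry \<Rightarrow> 'a entry set" where
  "sub_entries (User u) = {User u}"
| "sub_entries (Child es) = insert (Child es) (\<Union> (set (map sub_entries es)))"

definition entries :: "'a entry list \<Rightarrow> 'a entry set" where
  "entries T = (\<Union>e \<in> set T. sub_entries e)"

definition synopsis :: "('a, 'k) bigraph \<Rightarrow> 'a entry list \<Rightarrow> bool" where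
  "synopsis G T \<longleftrightarrow> (\<Union>e \<in> set T. under e) = users G"

definition entry_ub_sup :: "('a, 'k) bigraph \<Rightarrow> nat \<Rightarrow> 'a entry \<Rightarrow> nat" where
  "entry_ub_sup G r M = Max (insert 0 (user_ub_sup G r ` under M))"

definition safely_pruned :: "('a, 'k) bigraph \<Rightarrow> nat \<Rightarrow> nat \<Rightarrow> 'a entry \<Rightarrow> bool" where
  "safely_pruned G k r M \<longleftrightarrow>
     (\<forall>uc \<in> users G. \<forall>\<sigma> Q h. cd_sbn_answer G uc k r \<sigma> Q h \<longrightarrow> under M \<inter> verts h = {})"

end

theory Submission
  imports Defs
begin

text \<open>A user \<open>u\<close> of an answer \<open>h\<close> is an endpoint of some edge \<open>(u, v)\<close> of \<open>h\<close>, because \<open>h\<close> is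
  connected and has an edge.  Every butterfly of \<open>h\<close> through \<open>(u, v)\<close> is determined by its other item
  and its other user, and \<open>ub_sup\<close> counts such pairs in the larger graph \<open>G\<close>; hence
  \<open>k \<le> ub_sup G (u, v)\<close>.  For \<open>r \<ge> 1\<close> the edge \<open>(u, v)\<close> lies in the \<open>2r\<close>-hop subgraph of \<open>u\<close> itself,
  so the bound of every entry above \<open>u\<close> is at least \<open>k\<close>.  For \<open>r = 0\<close> the center is the only user of
  \<open>h\<close>, so \<open>h\<close> has no butterfly at all.\<close>

lemma bipartite_graphD:
  assumes "bipartite_graph g"
  shows "finite (users g)" "finite (items g)" "users g \<inter> items g = {}"
    "edges g \<subseteq> users g \<times> items g"
  using assms by (auto simp: bipartite_graph_def)

lemma finite_edges: "bipartite_graph g \<Longrightarrow> finite (edges g)"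
  using finite_subset[OF _ finite_cartesian_product] bipartite_graphD by metis

lemma finite_nbrs:
  assumes "bipartite_graph g"
  shows "finite (nbrs g x)"
proof (rule finite_subset)
  show "nbrs g x \<subseteq> snd ` edges g \<union> fst ` edges g"
    by (force simp: nbrs_def adj_def)
  show "finite (snd ` edges g \<union> fst ` edges g)"
    using finite_edges[OF assms] by simp
qed

lemma support_le_ub_sup:
  assumes "subgraph h G" "bipartite_graph G"
  shows "support h (u, v) \<le> ub_sup G (u, v)"
proof -
  let ?S = "SIGMA vx : nbrs G u - {v}. nbrs G v \<inter> nbrs G vx - {u}"
  let ?B = "{(A, B). (A, B) \<in> butterflies h \<and> (u, v) \<in> A \<times> B}"
  let ?f = "\<lambda>(vx, uj). ({u, uj}, {v, vx})"
  have fin: "finite ?S"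
    using assms(2) by (intro finite_SigmaI) (auto intro: finite_nbrs)
  have E: "edges h \<subseteq> edges G"
    using assms(1) by (simp add: subgraph_def)
  \<comment> \<open>\<open>?f\<close> rebuilds a butterfly from its other item and other user, so
    covering \<open>?B\<close> by the image of \<open>?S\<close> bounds its cardinality.\<close>
  have "?B \<subseteq> ?f ` ?S"
  proof
    fix b assume "b \<in> ?B"
    then obtain ui uj va vb where b: "b = ({ui, uj}, {va, vb})"
      and w: "wedge h ui va uj" "wedge h ui vb uj" "va \<noteq> vb"
      and u: "u = ui \<or> u = uj" and v: "v = va \<or> v = vb"
      by (auto simp: butterflies_def)
    obtain u' where u': "{ui, uj} = {u, u'}" "u' \<noteq> u"
      using u w(1) by (auto simp: wedge_def)
    obtain v' where v': "{va, vb} = {v, v'}" "v' \<noteq> v"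
      using v w(3) by auto
    have "\<forall>x \<in> {ui, uj}. \<forall>y \<in> {va, vb}. (x, y) \<in> edges h"
      using w by (auto simp: wedge_def)
    \<comment> \<open>The three edges of the butterfly besides \<open>(u, v)\<close> are exactly the
      adjacencies that \<open>?S\<close> asks of \<open>(v', u')\<close>.\<close>
    then have "{(u, v'), (u', v), (u', v')} \<subseteq> edges G"
      using E unfolding u' v' by blast
    then have "(v', u') \<in> ?S"
      using u' v' by (auto simp: nbrs_def adj_def)
    then show "b \<in> ?f ` ?S"
      using b u' v' by (force simp: image_iff)
  qed
  then have "card ?B \<le> card ?S"
    using fin by (meson card_image_le card_mono finite_imageI le_trans)
  also have "card ?S = ub_sup G (u, v)"
    using assms(2) by (simp add: ub_sup_def finite_nbrs)
  finally show ?thesis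
    by (simp add: support_def)
qed

text \<open>A user differs from the item end of any edge, so a walk between them has a first step;
  disjointness of users and items orients that step as an edge leaving \<open>u\<close>.\<close>

lemma connected_graph_incident_edge:
  assumes "bipartite_graph h" "connected_graph h" "edges h \<noteq> {}" "u \<in> users h"
  obtains v where "(u, v) \<in> edges h"
proof -
  obtain a b where ab: "(a, b) \<in> edges h"
    using assms(3) by auto
  have "(u, b) \<in> (adj h)\<^sup>*" "u \<noteq> b"
    using ab assms(2,4) bipartite_graphD[OF assms(1)]
    by (auto simp: connected_graph_def verts_def)
  then obtain y where "(u, y) \<in> adj h"
    by (blast elim: converse_rtranclE)
  then have "(u, y) \<in> edges h"
    using assms(4) bipartite_graphD[OF assms(1)] by (auto simp: adj_def)
  then show ?thesis
    by (rule that)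
qed

lemma graph_dist_le: "(x, y) \<in> adj g ^^ n \<Longrightarrow> graph_dist g x y \<le> enat n"
  unfolding graph_dist_def by (rule Inf_lower) auto

text \<open>The infimum of the empty set is infinite, so distance 0 means that walks exist. Their
  least length is then attained, and a walk of length 0 stays in place.\<close>

lemma graph_dist_eq_0_imp_eq:
  assumes "graph_dist g x y = 0"
  shows "x = y"
proof -
  let ?N = "{enat n | n. (x, y) \<in> adj g ^^ n}"
  have "?N \<noteq> {}"
    using assms by (auto simp: graph_dist_def Inf_enat_def split: if_splits)
  then have "Inf ?N \<in> ?N"
    unfolding Inf_enat_def by (metis (mono_tags, lifting) LeastI ex_in_conv)
  then show ?thesis
    using assms by (auto simp: graph_dist_def zero_enat_def)
qed

lemma support_pos_two_users:
  assumes "bipartite_graph h" "support h e > 0"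
  obtains u u' where "u \<in> users h" "u' \<in> users h" "u \<noteq> u'"
proof -
  have "butterflies h \<noteq> {}"
  proof
    assume "butterflies h = {}"
    then have "support h e = 0"
      by (simp add: support_def)
    then show False
      using assms(2) by simp
  qed
  then obtain ui uj v where "wedge h ui v uj"
    unfolding butterflies_def by blast
  then show ?thesis
    using bipartite_graphD(4)[OF assms(1)] by (intro that[of ui uj]) (auto simp: wedge_def)
qed

text \<open>The item end is at distance at most 1 from \<open>u\<close>, so radius 1 already
  captures the edge.\<close>

lemma edge_in_hop:
  assumes "bipartite_graph G" "(u, v) \<in> edges G" "d \<ge> 1"
  shows "(u, v) \<in> edges (hop G u d)"
proof -
  have "graph_dist G u u \<le> enat 0"
    by (rule graph_dist_le) simp
  moreover have "graph_dist G u v \<le> enat 1"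
    using assms(2) by (intro graph_dist_le) (simp add: adj_def)
  ultimately have "graph_dist G u u \<le> enat d" "graph_dist G u v \<le> enat d"
    using assms(3) by (meson enat_ord_simps(1) le0 order_trans)+
  then show ?thesis
    using assms(2) by (simp add: hop_def Let_def)
qed

lemma ub_sup_le_user_ub_sup:
  assumes "bipartite_graph G" "e \<in> edges (hop G u (2 * r))"
  shows "ub_sup G e \<le> user_ub_sup G r u"
proof -
  have "finite (edges (hop G u (2 * r)))"
    using finite_edges[OF assms(1)] by (simp add: hop_def Let_def)
  then show ?thesis
    using assms(2) unfolding user_ub_sup_def by (intro Max_ge) auto
qed

lemma finite_under: "finite (under M)"
  by (induction M) auto

lemma user_ub_sup_le_entry_ub_sup: "u \<in> under M \<Longrightarrow> user_ub_sup G r u \<le> entry_ub_sup G r M"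
  unfolding entry_ub_sup_def by (intro Max_ge) (auto simp: finite_under)

lemma under_sub_entries: "e \<in> sub_entries e' \<Longrightarrow> under e \<subseteq> under e'"
proof (induction e')
  case (User u)
  then show ?case by simp
next
  case (Child es)
  show ?case
  proof (cases "e = Child es")
    case False
    then obtain e' where "e' \<in> set es" "e \<in> sub_entries e'"
      using Child.prems by auto
    then have "under e \<subseteq> under e'"
      by (rule Child.IH)
    then show ?thesis
      using \<open>e' \<in> set es\<close> by auto
  qed simp
qed

text \<open>Ensures that an entry can meet an answer only in users, never in items.\<close>

lemma under_subset_users:
  assumes "synopsis G T" "M \<in> entries T"
  shows "under M \<subseteq> users G"
proof -
  obtain e where "e \<in> set T" "M \<in> sub_entries e"
    using assms(2) by (auto simp: entries_def)
  then have "under M \<subseteq> (\<Union>e \<in> set T. under e)"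
    using under_sub_entries by blast
  then show ?thesis
    using assms(1) by (simp add: synopsis_def)
qed

theorem lemma7:
  fixes G :: "('a, 'k) bigraph"
    and T :: "'a entry list"
    and M :: "'a entry"
    and k r :: nat
  assumes "bipartite_graph G"
    and "synopsis G T"
    and "M \<in> entries T"
    and "entry_ub_sup G r M < k"
  shows "safely_pruned G k r M"
  unfolding safely_pruned_def
proof (intro ballI allI impI, rule ccontr)
  fix uc \<sigma> and Q :: "'k set" and h
  assume "cd_sbn_answer G uc k r \<sigma> Q h" and "under M \<inter> verts h \<noteq> {}"
  then obtain u where u: "u \<in> under M" "u \<in> verts h" and h: "bitruss G uc k r \<sigma> h"
    by (auto simp: cd_sbn_answer_def)
  have sub: "subgraph h G" and bip: "bipartite_graph h"
    using h by (auto simp: bitruss_def subgraph_def)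
  have "u \<in> users h"
    using u under_subset_users[OF assms(2,3)] sub bipartite_graphD(3)[OF assms(1)]
    by (auto simp: verts_def subgraph_def)
  then obtain v where v: "(u, v) \<in> edges h"
    using h bip connected_graph_incident_edge by (metis bitruss_def)
  have sup: "k \<le> support h (u, v)"
    using h v by (simp add: bitruss_def)
  \<comment> \<open>For \<open>r = 0\<close> every hop subgraph is a single vertex without edges, so
    the bound is 0 and says nothing about \<open>(u, v)\<close>; the radius condition gives the
    contradiction instead.\<close>
  have "r \<noteq> 0"
  proof
    assume "r = 0"
    then have "x = uc" if "x \<in> users h" for x
      using that h graph_dist_eq_0_imp_eq[of h uc x]
      by (auto simp: bitruss_def zero_enat_def[symmetric])
    \<comment> \<open>The strict inequality \<open>entry_ub_sup G r M < k\<close> forces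
      \<open>k\<close> to be positive.\<close>
    moreover have "support h (u, v) > 0"
      using sup assms(4) by simp
    ultimately show False
      using support_pos_two_users[OF bip] by metis
  qed
  \<comment> \<open>The hop subgraph is centered at \<open>u\<close>, not at \<open>uc\<close>,
    since the bound of \<open>M\<close> ranges over the users under \<open>M\<close>.\<close>
  then have "(u, v) \<in> edges (hop G u (2 * r))"
    using v sub assms(1) by (intro edge_in_hop) (auto simp: subgraph_def)
  then have "ub_sup G (u, v) \<le> entry_ub_sup G r M"
    using ub_sup_le_user_ub_sup user_ub_sup_le_entry_ub_sup u(1) assms(1) order_trans by metis
  then show False
    using sup support_le_ub_sup[OF sub assms(1), of u v] assms(4) by simp
qed

end
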